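(* Let $f\colon\mathbb{N}\to\mathbb{N}$ be an arbitrary computable function. No online algorithm with advice that reads at most $f(n)$ advice bits on instances of length $n$ solves the simple unbounded knapsack problem optimally (i.e., with $\mathrm{gain}(I)=\mathrm{opt}(I)$ on every instance $I$).
   Context: Online simple unbounded knapsack problem: knapsack capacity $1$; an instance is a sequence of items $x_1,\dots,x_n$ ($n$ unknown to the algorithm) with sizes $s_i\in[0,1]$ and values $v_i=s_i$. Items arrive one by one; upon arrival of $x_i$ the algorithm irrevocably chooses a number $k_i\in\mathbb{N}_0$ of copies to pack, with the total packed size never exceeding $1$. $\mathrm{gain}(I)$ is the total packed value and $\mathrm{opt}(I)=\max\{\sum_i k_i v_i: k_i\in\mathbb{N}_0,\sum_i k_i s_i\le1\}$. Advice model (tape model): an oracle knowing the whole instance writes an infinite binary advice string, which the deterministic online algorithm may read from the beginning; the algorithm uses $f(n)$ advice bits if on every instance with $n$ items it reads at most the first $f(n)$ bits. *)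

theory Defs
  imports Complex_Main
begin

section \<open>Computable functions\<close>

text \<open>Kleene's mu-recursive functions. Arguments of a program are passed as a list;
  \<open>Mu g\<close> searches for the least zero of \<open>g\<close> in its first argument.\<close>

datatype recf =
    Zero
  | Succ
  | Proj nat
  | Comp recf "recf list"
  | PrimRec recf recf
  | Mu recf

inductive rec_eval :: "recf \<Rightarrow> nat list \<Rightarrow> nat \<Rightarrow> bool" where
  zero: "rec_eval Zero xs 0"
| succ: "rec_eval Succ (x # xs) (Suc x)"
| proj: "i < length xs \<Longrightarrow> rec_eval (Proj i) xs (xs ! i)"
| comp: "length ys = length gs \<Longrightarrow> \<forall>i < length gs. rec_eval (gs ! i) xs (ys ! i)
    \<Longrightarrow> rec_eval h ys z \<Longrightarrow> rec_eval (Comp h gs) xs z"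
| prim_0: "rec_eval g xs y \<Longrightarrow> rec_eval (PrimRec g h) (0 # xs) y"
| prim_Suc: "rec_eval (PrimRec g h) (n # xs) r \<Longrightarrow> rec_eval h (n # r # xs) y
    \<Longrightarrow> rec_eval (PrimRec g h) (Suc n # xs) y"
| mu: "rec_eval g (n # xs) 0 \<Longrightarrow> \<forall>m < n. \<exists>y. rec_eval g (m # xs) (Suc y)
    \<Longrightarrow> rec_eval (Mu g) xs n"

definition computable :: "(nat \<Rightarrow> nat) \<Rightarrow> bool" where
  "computable f \<longleftrightarrow> (\<exists>p. \<forall>n. rec_eval p [n] (f n))"

section \<open>The simple unbounded knapsack problem\<close>

datatype item = Item (item_size: real) (item_value: real)

definition simple_instance :: "item list \<Rightarrow> bool" where
  "simple_instance I \<longleftrightarrow>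
     (\<forall>x \<in> set I. 0 \<le> item_size x \<and> item_size x \<le> 1 \<and> item_value x = item_size x)"

text \<open>A packing of \<open>I\<close> is a list \<open>ks\<close> of the same length; \<open>ks ! i\<close> is the number of
  copies of item \<open>I ! i\<close>.\<close>

definition packed_size :: "item list \<Rightarrow> nat list \<Rightarrow> real" where
  "packed_size I ks = (\<Sum>i < length I. real (ks ! i) * item_size (I ! i))"

definition gain :: "item list \<Rightarrow> nat list \<Rightarrow> real" where
  "gain I ks = (\<Sum>i < length I. real (ks ! i) * item_value (I ! i))"

definition opt :: "item list \<Rightarrow> real" where
  "opt I = Max {gain I ks | ks. length ks = length I \<and> packed_size I ks \<le> 1}"

text \<open>The maximum exists even if some sizes are \<open>0\<close>, where there are infinitely many
  packings.\<close>

lemma finite_gains: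
  assumes "simple_instance I"
  shows "finite {gain I ks | ks. length ks = length I \<and> packed_size I ks \<le> 1}"
proof -
  obtain N :: nat where N: "\<And>i. i < length I \<Longrightarrow> item_size (I ! i) \<noteq> 0 \<Longrightarrow> 1 / item_size (I ! i) \<le> real N"
  proof -
    obtain N :: nat where N: "(\<Sum>i < length I. \<bar>1 / item_size (I ! i)\<bar>) \<le> real N"
      using real_arch_simple by blast
    have "1 / item_size (I ! i) \<le> real N" if "i < length I" for i
    proof -
      have "\<bar>1 / item_size (I ! i)\<bar> \<le> (\<Sum>i < length I. \<bar>1 / item_size (I ! i)\<bar>)"
        using that by (intro member_le_sum) auto
      with N show ?thesis by linarith
    qed
    then show ?thesis using that by blast
  qed
  let ?K = "{ks. set ks \<subseteq> {..N} \<and> length ks = length I}"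
  have "{gain I ks | ks. length ks = length I \<and> packed_size I ks \<le> 1} \<subseteq> gain I ` ?K"
  proof safe
    fix ks assume len: "length ks = length I" and le: "packed_size I ks \<le> 1"
    have I: "0 \<le> item_size (I ! i)" "item_value (I ! i) = item_size (I ! i)"
      if "i < length I" for i
      using assms that by (auto simp: simple_instance_def)
    define ks' where "ks' = map (\<lambda>i. if item_size (I ! i) = 0 then 0 else ks ! i) [0..<length I]"
    have "gain I ks = gain I ks'"
      unfolding gain_def by (rule sum.cong) (auto simp: ks'_def I)
    moreover have "ks ! i \<le> N" if i: "i < length I" and nz: "item_size (I ! i) \<noteq> 0" for i
    proof -
      have "real (ks ! i) * item_size (I ! i) \<le> packed_size I ks"
        unfolding packed_size_def using i I
        by (intro member_le_sum[where f = "\<lambda>i. real (ks ! i) * item_size (I ! i)"]) auto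
      then have "real (ks ! i) \<le> 1 / item_size (I ! i)"
        using le I(1)[OF i] nz by (simp add: field_simps)
      then have "real (ks ! i) \<le> real N" using N[OF i nz] by linarith
      then show ?thesis by simp
    qed
    then have "ks' \<in> ?K" by (auto simp: ks'_def)
    ultimately show "gain I ks \<in> gain I ` ?K" by blast
  qed
  moreover have "finite ?K" by (rule finite_lists_length_eq) simp
  ultimately show ?thesis by (meson finite_imageI finite_subset)
qed

section \<open>Online algorithms with advice\<close>

text \<open>An algorithm sees the items revealed so far (the current one last) and the advice bits
  read so far, and either requests the next bit of the tape or fixes the number of copies of the
  current item. Its own earlier actions are determined by these data.\<close>

datatype action = Read_Bit | Pack nat

type_synonym online_algorithm = "item list \<Rightarrow> bool list \<Rightarrow> action"

type_synonym advice = "nat \<Rightarrow> bool"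

text \<open>\<open>serve A \<phi> xs r k r'\<close>: if \<open>r\<close> bits of the tape \<open>\<phi>\<close> have been read when the last item
  of \<open>xs\<close> arrives, then \<open>A\<close> packs \<open>k\<close> copies of it, having read \<open>r'\<close> bits in total.\<close>

inductive serve :: "online_algorithm \<Rightarrow> advice \<Rightarrow> item list \<Rightarrow> nat \<Rightarrow> nat \<Rightarrow> nat \<Rightarrow> bool"
  for A \<phi> xs where
  pack: "A xs (map \<phi> [0..<r]) = Pack k \<Longrightarrow> serve A \<phi> xs r k r"
| read: "A xs (map \<phi> [0..<r]) = Read_Bit \<Longrightarrow> serve A \<phi> xs (Suc r) k r'
    \<Longrightarrow> serve A \<phi> xs r k r'"

text \<open>\<open>run A \<phi> xs ks r\<close>: on the items \<open>xs\<close> and tape \<open>\<phi>\<close>, \<open>A\<close> makes the decisions \<open>ks\<close> and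
  reads exactly the first \<open>r\<close> bits.\<close>

inductive run :: "online_algorithm \<Rightarrow> advice \<Rightarrow> item list \<Rightarrow> nat list \<Rightarrow> nat \<Rightarrow> bool"
  for A \<phi> where
  start: "run A \<phi> [] [] 0"
| step: "run A \<phi> xs ks r \<Longrightarrow> serve A \<phi> (xs @ [x]) r k r'
    \<Longrightarrow> run A \<phi> (xs @ [x]) (ks @ [k]) r'"

lemma serve_deterministic:
  assumes "serve A \<phi> xs r k r'" "serve A \<phi> xs r l s'"
  shows "k = l \<and> r' = s'"
  using assms
proof (induction arbitrary: l s' rule: serve.induct)
  case (pack r k)
  from pack(2) show ?case by cases (simp_all add: pack(1))
next
  case (read r k r')
  note IH = read.IH and hyp = read.hyps(1)
  from read.prems show ?case
  proof cases
    case pack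
    with hyp show ?thesis by simp
  next
    case read
    from read(2) show ?thesis by (rule IH)
  qed
qed

lemma run_deterministic:
  assumes "run A \<phi> xs ks r" "run A \<phi> xs ls s"
  shows "ks = ls \<and> r = s"
  using assms
proof (induction arbitrary: ls s rule: run.induct)
  case start
  then show ?case by cases simp_all
next
  case (step xs ks r x k r')
  from step.prems obtain ls' s' l where *: "ls = ls' @ [l]"
    "run A \<phi> xs ls' s'" "serve A \<phi> (xs @ [x]) s' l s"
    by cases simp_all
  from step.IH[OF *(2)] have "ks = ls'" "r = s'" by simp_all
  with serve_deterministic[OF step.hyps(2)] * show ?case by simp
qed

text \<open>In the following, \<open>adv I\<close> is the advice string prepared for the instance \<open>I\<close>.\<close>

definition online_knapsack_algorithm ::
    "online_algorithm \<Rightarrow> (item list \<Rightarrow> advice) \<Rightarrow> bool" where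
  "online_knapsack_algorithm A adv \<longleftrightarrow>
     (\<forall>I. simple_instance I \<longrightarrow>
       (\<exists>ks r. run A (adv I) I ks r \<and>
          (\<forall>j \<le> length I. packed_size (take j I) (take j ks) \<le> 1)))"

definition reads_at_most ::
    "online_algorithm \<Rightarrow> (item list \<Rightarrow> advice) \<Rightarrow> (nat \<Rightarrow> nat) \<Rightarrow> bool" where
  "reads_at_most A adv f \<longleftrightarrow>
     (\<forall>I ks r. simple_instance I \<longrightarrow> run A (adv I) I ks r \<longrightarrow> r \<le> f (length I))"

definition solves_optimally ::
    "online_algorithm \<Rightarrow> (item list \<Rightarrow> advice) \<Rightarrow> bool" where
  "solves_optimally A adv \<longleftrightarrow>
     (\<forall>I ks r. simple_instance I \<longrightarrow> run A (adv I) I ks r \<longrightarrow> gain I ks = opt I)"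

end

theory Submission
  imports Defs
begin

text \<open>Two items suffice. The first has size \<open>s = 2 / (4 N + 1)\<close> with \<open>N = 2 ^ f 2\<close>, the second
  has size \<open>1 - k s > 1/2\<close> for some \<open>k \<le> N\<close>. As \<open>1\<close> is not a multiple of \<open>s\<close>, the only
  packing of size \<open>1\<close> consists of \<open>k\<close> copies of the first item and one copy of the second.
  The number of copies of the first item depends on at most \<open>f 2\<close> bits, so it takes at most
  \<open>N\<close> values over the \<open>N + 1\<close> possible choices of \<open>k\<close>.\<close>

lemma serve_mono: "serve A \<phi> xs r k r' \<Longrightarrow> r \<le> r'"
  by (induction rule: serve.induct) auto

text \<open>Serving an item inspects only the tape cells below the final read position
  \<open>r'\<close>, so tapes that agree there lead to the same decision.\<close>

lemma serve_cong:
  assumes "serve A \<phi> xs r k r'" "\<And>i. i < r' \<Longrightarrow> \<phi> i = \<psi> i"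
  shows "serve A \<psi> xs r k r'"
  using assms
proof (induction rule: serve.induct)
  case (pack r k)
  have "map \<psi> [0..<r] = map \<phi> [0..<r]"
    using pack.prems by simp
  with pack.hyps have "A xs (map \<psi> [0..<r]) = Pack k" by (simp only:)
  then show ?case by (rule serve.pack)
next
  case (read r k r')
  have "map \<psi> [0..<r] = map \<phi> [0..<r]"
    using read.prems serve_mono[OF read.hyps(2)] by simp
  with read.hyps(1) have "A xs (map \<psi> [0..<r]) = Read_Bit" by (simp only:)
  then show ?case by (rule serve.read) (rule read.IH[OF read.prems])
qed

text \<open>Isolates the decision on the first item: it is taken when only \<open>[x]\<close> is
  visible, so \<open>y\<close> can influence it only through the tape.\<close>

lemma run_two_items:
  assumes "run A \<phi> [x, y] ks r"
  obtains a b r' where "ks = [a, b]" "serve A \<phi> [x] 0 a r'" "r' \<le> r"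
proof -
  from assms obtain ks' r' b where y: "ks = ks' @ [b]" "run A \<phi> [x] ks' r'" "serve A \<phi> [x, y] r' b r"
    by cases auto
  from y(2) obtain ks0 r0 a where x: "ks' = ks0 @ [a]" "run A \<phi> [] ks0 r0" "serve A \<phi> [x] r0 a r'"
    by cases auto
  from x(2) have "ks0 = [] \<and> r0 = 0" by cases auto
  with x y serve_mono[OF y(3)] that show ?thesis by auto
qed

lemma gain_eq_packed_size: "simple_instance I \<Longrightarrow> gain I ks = packed_size I ks"
  unfolding gain_def packed_size_def by (rule sum.cong) (auto simp: simple_instance_def)

lemma opt_eq_1:
  assumes "simple_instance I" "length ks = length I" "packed_size I ks = 1"
  shows "opt I = 1"
  unfolding opt_def
proof (rule Max_eqI[OF finite_gains[OF assms(1)]])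
  show "1 \<in> {gain I ks | ks. length ks = length I \<and> packed_size I ks \<le> 1}"
    using assms by (auto simp: gain_eq_packed_size intro!: exI[of _ ks])
qed (use assms in \<open>auto simp: gain_eq_packed_size\<close>)

lemma two_items_size_1_unique:
  fixes N k a b :: nat and s :: real
  defines "s \<equiv> 2 / (4 * real N + 1)"
  assumes "k \<le> N" "real a * s + real b * (1 - real k * s) = 1"
  shows "a = k"
proof -
  have eq: "2 * real a + real b * (4 * real N + 1 - 2 * real k) = 4 * real N + 1"
  proof -
    define D where "D = 4 * real N + 1"
    have "D > 0" by (simp add: D_def add_nonneg_pos)
    then have "s * D = 2" by (simp add: s_def flip: D_def)
    moreover have "(real a * s + real b * (1 - real k * s)) * D
        = real a * (s * D) + real b * (D - real k * (s * D))"
      by (simp add: algebra_simps)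
    ultimately show ?thesis using assms(3) by (simp add: D_def mult.commute)
  qed
  \<comment> \<open>With \<open>d\<close> for the difference, the coefficient
    \<open>4 * N + 1 - 2 * k\<close> becomes \<open>2 * k + 4 * d + 1\<close>, so the equation moves
    to the naturals without subtraction.\<close>
  obtain d where d: "N = k + d" using assms(2) le_Suc_ex by blast
  have "real (2 * a + b * (2 * k + 4 * d + 1)) = real (4 * k + 4 * d + 1)"
    using eq unfolding d by (simp add: algebra_simps)
  then have nat_eq: "2 * a + b * (2 * k + 4 * d + 1) = 4 * k + 4 * d + 1"
    by (simp only: of_nat_eq_iff)
  consider "b = 0" | "b = 1" | "2 \<le> b" by linarith
  then show ?thesis
  proof cases
    case 1
    with nat_eq have "2 * a = 4 * k + 4 * d + 1" by simp
    \<comment> \<open>Contradiction by parity.\<close>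
    then show ?thesis by presburger
  next
    case 2
    with nat_eq show ?thesis by simp
  next
    case 3
    \<comment> \<open>The second item is larger than half the capacity, so two copies
      overflow.\<close>
    have "4 * k + 4 * d + 1 < 2 * (2 * k + 4 * d + 1)" by simp
    also have "\<dots> \<le> b * (2 * k + 4 * d + 1)" using 3 by (rule mult_le_mono1)
    also have "\<dots> \<le> 4 * k + 4 * d + 1" using le_add2 by (rule ord_le_eq_trans[OF _ nat_eq])
    finally have False by (simp only: less_irrefl)
    then show ?thesis ..
  qed
qed

text \<open>There are \<open>2 ^ m + 1\<close> indices up to \<open>2 ^ m\<close>, but only
  \<open>2 ^ m\<close> bit strings of length \<open>m\<close>.\<close>

lemma bool_prefix_pigeonhole:
  fixes \<Phi> :: "nat \<Rightarrow> nat \<Rightarrow> bool"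
  obtains k l where "k \<le> 2 ^ m" "l \<le> 2 ^ m" "k \<noteq> l" "\<And>i. i < m \<Longrightarrow> \<Phi> k i = \<Phi> l i"
proof -
  let ?h = "\<lambda>k. map (\<Phi> k) [0..<m]"
  let ?L = "{bs :: bool list. set bs \<subseteq> UNIV \<and> length bs = m}"
  have "card (?h ` {..2 ^ m}) \<le> card ?L"
    by (intro card_mono finite_lists_length_eq) auto
  also have "card ?L = 2 ^ m"
    by (subst card_lists_length_eq) auto
  finally have "\<not> inj_on ?h {..2 ^ m}"
    by (intro pigeonhole) simp
  then obtain k l where "k \<le> 2 ^ m" "l \<le> 2 ^ m" "k \<noteq> l" "?h k = ?h l"
    by (auto simp: inj_on_def)
  then show ?thesis by (intro that[of k l]) auto
qed

theorem theorem7: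
  fixes f :: "nat \<Rightarrow> nat"
  assumes "computable f"
  shows "\<not> (\<exists>A adv. online_knapsack_algorithm A adv \<and> reads_at_most A adv f
           \<and> solves_optimally A adv)"
proof
  assume "\<exists>A adv. online_knapsack_algorithm A adv \<and> reads_at_most A adv f
           \<and> solves_optimally A adv"
  then obtain A adv where alg: "online_knapsack_algorithm A adv"
    and bits: "reads_at_most A adv f" and optimal: "solves_optimally A adv"
    by blast
  define N :: nat where "N = 2 ^ f 2"
  define s where "s = 2 / (4 * real N + 1)"
  define t where "t k = 1 - real k * s" for k :: nat
  define I where "I k = [Item s s, Item (t k) (t k)]" for k
  have N: "1 \<le> N" by (simp add: N_def)
  have s: "0 \<le> s" "s \<le> 1" using N by (auto simp: s_def field_simps)
  have simple: "simple_instance (I k)" if "k \<le> N" for k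
  proof -
    have "real k * s \<le> 1"
      using that by (simp add: s_def field_simps)
    then show ?thesis using s by (auto simp: simple_instance_def I_def t_def)
  qed
  have size: "packed_size (I k) [a, b] = real a * s + real b * t k" for k a b
    by (simp add: packed_size_def I_def)
  \<comment> \<open>The first item does not depend on \<open>k\<close>, yet optimality forces
    exactly \<open>k\<close> copies of it, since \<open>[k, 1]\<close> fills the knapsack.\<close>
  have first: "\<exists>r \<le> f 2. serve A (adv (I k)) [Item s s] 0 k r" if k: "k \<le> N" for k
  proof -
    note sim = simple[OF k]
    obtain ks r where run: "run A (adv (I k)) (I k) ks r"
      using alg sim unfolding online_knapsack_algorithm_def by blast
    then obtain a b r' where ks: "ks = [a, b]" and serve: "serve A (adv (I k)) [Item s s] 0 a r'"
      and "r' \<le> r"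
      unfolding I_def by (rule run_two_items)
    have "r \<le> f (length (I k))"
      using bits sim run unfolding reads_at_most_def by blast
    then have "r \<le> f 2" by (simp add: I_def numeral_2_eq_2)
    have "opt (I k) = 1"
      by (rule opt_eq_1[OF sim, of "[k, 1]"]) (simp add: I_def, simp add: size t_def)
    with optimal sim run have "gain (I k) ks = 1"
      unfolding solves_optimally_def by metis
    then have "real a * s + real b * t k = 1"
      using gain_eq_packed_size[OF sim] by (simp add: ks size)
    then have "a = k"
      using two_items_size_1_unique[OF k] unfolding s_def t_def by blast
    with serve \<open>r' \<le> r\<close> \<open>r \<le> f 2\<close> show ?thesis by (meson le_trans)
  qed
  obtain k l where kl: "k \<le> N" "l \<le> N" "k \<noteq> l"
    and same: "\<And>i. i < f 2 \<Longrightarrow> adv (I k) i = adv (I l) i"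
    using bool_prefix_pigeonhole[of "f 2" "\<lambda>k. adv (I k)"] unfolding N_def by blast
  obtain r where r: "r \<le> f 2" "serve A (adv (I k)) [Item s s] 0 k r"
    using first[OF kl(1)] by blast
  obtain r' where r': "serve A (adv (I l)) [Item s s] 0 l r'"
    using first[OF kl(2)] by blast
  \<comment> \<open>The two tapes agree on all bits read so far, so on the tape for
    \<open>I l\<close> the algorithm would pack both \<open>k\<close> and \<open>l\<close> copies of
    the first item.\<close>
  have "serve A (adv (I l)) [Item s s] 0 k r"
    using r same by (intro serve_cong[OF r(2)]) auto
  then have "k = l" using serve_deterministic r' by blast
  with kl show False by simp
qed

end
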